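(* Let $\lambda_j,\mu_j$ be real numbers with $0\le\lambda_j\le\mu_j$ for $j=0,\dots,n$. Then $\Phi_{(\lambda_0,\dots,\lambda_n)}(x)$ is real for all $x\in\mathbb{R}$, $\Phi_{(\lambda_0,\dots,\lambda_n)}(x)>0$ for all $x>0$, and $$\left|\Phi_{(\lambda_0,\dots,\lambda_n)}(z)\right|\le\Phi_{(\mu_0,\dots,\mu_n)}(|z|)\quad\text{for all }z\in\mathbb{C}.$$
   Context: For $\lambda_0,\dots,\lambda_n\in\mathbb{C}$ the fundamental function is the entire function $\Phi_{(\lambda_0,\dots,\lambda_n)}(z)=\frac{1}{2\pi i}\int_{|w|=R}\frac{e^{zw}}{(w-\lambda_0)\cdots(w-\lambda_n)}\,dw$, where $R>\max_j|\lambda_j|$ and the circle is positively oriented. *)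

theory Defs
  imports "HOL-Analysis.Analysis"
begin

text \<open>Contour integral over the positively oriented circle |w| = R, parametrised by
  t in [0,1] as R * exp(2 pi i t), written out literally (as in the definition of
  contour_integral in HOL-Complex_Analysis, which is not importable here).\<close>

definition circlepath_R :: "real \<Rightarrow> real \<Rightarrow> complex" where
  "circlepath_R R t = complex_of_real R * exp (2 * complex_of_real pi * \<i> * complex_of_real t)"

definition fundamental_fun :: "nat \<Rightarrow> (nat \<Rightarrow> complex) \<Rightarrow> complex \<Rightarrow> complex" where
  "fundamental_fun n lam z =
     (let R = Max ((\<lambda>j. cmod (lam j)) ` {0..n}) + 1;
          \<gamma> = circlepath_R R
      in integral {0..1}
           (\<lambda>t. exp (z * \<gamma> t) / (\<Prod>j=0..n. \<gamma> t - lam j)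
                 * vector_derivative \<gamma> (at t within {0..1}))
         / (2 * complex_of_real pi * \<i>))"

end

theory Submission
  imports Defs
begin

(* Write g(t) = R e^{2 pi i t} for the circle of Defs, and P_m(t) for
   (g t - c_0) ... (g t - c_{m-1}).  Since g' = 2 pi i g, the contour integral defining
   Phi is the plain integral over [0,1] of exp(z g) g / P_{n+1}.  Expanding exp termwise
   (uniform convergence on the compact circle) gives
       Phi(z) = sum_k z^k / k! * M(k+1, n+1),   M(p, m) = int_0^1 g^p / P_m dt.
   The moments M(p, m) satisfy the recursion of the complete homogeneous symmetric
   polynomials, M(p+1, m+1) = M(p, m) + c_m M(p, m+1), with M(p, 0) = [p = 0] and
   M(0, m+1) = 0; the latter vanishing is shown by a geometric-series expansion of
   1/(g - c_m).  Hence M(k+1, n+1) = h_{k-n}(c_0, ..., c_n), a polynomial with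
   nonnegative coefficients, which is nonnegative, monotone in nonnegative arguments
   and equal to 1 for k = n.  All three claims of the theorem then follow by
   comparing power series coefficientwise. *)

lemma integral_suminf_dominated:
  fixes f :: "nat \<Rightarrow> real \<Rightarrow> 'a::banach"
  assumes cont: "\<And>i. continuous_on {a..b} (f i)"
    and bound: "\<And>i t. t \<in> {a..b} \<Longrightarrow> norm (f i t) \<le> M i" and summable: "summable M"
  shows "(\<lambda>i. integral {a..b} (f i)) sums integral {a..b} (\<lambda>t. \<Sum>i. f i t)"
proof -
  have unif: "uniform_limit {a..b} (\<lambda>n t. \<Sum>i<n. f i t) (\<lambda>t. \<Sum>i. f i t) sequentially"
    by (rule Weierstrass_m_test[OF bound summable])
  have partial_cont: "\<And>n. continuous_on {a..b} (\<lambda>t. \<Sum>i<n. f i t)"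
    by (intro continuous_intros cont)
  obtain I J where I: "\<And>n. ((\<lambda>t. \<Sum>i<n. f i t) has_integral I n) {a..b}"
    and J: "((\<lambda>t. \<Sum>i. f i t) has_integral J) {a..b}" and lim: "I \<longlonglongrightarrow> J"
    using uniform_limit_integral[OF unif partial_cont] by auto
  have "I = (\<lambda>n. \<Sum>i<n. integral {a..b} (f i))"
  proof
    fix n
    have "((\<lambda>t. \<Sum>i<n. f i t) has_integral (\<Sum>i<n. integral {a..b} (f i))) {a..b}"
      by (intro has_integral_sum) (auto intro: integrable_continuous_real cont)
    then show "I n = (\<Sum>i<n. integral {a..b} (f i))" using I[of n] has_integral_unique by blast
  qed
  moreover have "J = integral {a..b} (\<lambda>t. \<Sum>i. f i t)" using J by (simp add: integral_unique)
  ultimately show ?thesis using lim unfolding sums_def by simp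
qed

lemma integral_exp_2pi_int:
  fixes k :: int
  shows "integral {0..1} (\<lambda>t::real. exp (2 * of_real pi * \<i> * of_int k * of_real t))
       = (if k = 0 then 1 else 0)"
proof (cases "k = 0")
  case False
  define a where "a = 2 * of_real pi * \<i> * (of_int k :: complex)"
  have a_nz: "a \<noteq> 0" using False by (simp add: a_def)
  have antideriv: "((\<lambda>t. exp (a * of_real t) / a) has_vector_derivative exp (a * of_real t))
                     (at t within {0..1})" for t
  proof -
    have "((\<lambda>w. exp (a * w) / a) has_field_derivative exp (a * of_real t)) (at (of_real t))"
      using a_nz by (auto intro!: derivative_eq_intros)
    then show ?thesis by (rule has_vector_derivative_real_field)
  qed
  have "((\<lambda>t. exp (a * of_real t)) has_integral (exp (a * of_real 1) / a - exp (a * of_real 0) / a))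
          {0..1::real}"
    by (rule fundamental_theorem_of_calculus) (auto intro: antideriv)
  moreover have "exp (a * of_real 1) = 1"
    using exp_integer_2pi[of "of_int k"] by (simp add: a_def mult_ac)
  ultimately have "((\<lambda>t. exp (a * of_real t)) has_integral 0) {0..1::real}" by simp
  then show ?thesis using False by (simp add: a_def integral_unique mult_ac)
qed simp

lemma divide_by_ge_one_le: "0 \<le> (x::real) \<Longrightarrow> 1 \<le> y \<Longrightarrow> x / y \<le> x"
  by (metis div_by_1 divide_left_mono mult_pos_pos zero_less_one less_le_trans)

lemma norm_circlepath_R: "R \<ge> 0 \<Longrightarrow> norm (circlepath_R R t) = R"
  by (simp add: circlepath_R_def norm_mult norm_exp_eq_Re)

lemma circlepath_R_nonzero: "R > 0 \<Longrightarrow> circlepath_R R t \<noteq> 0"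
  by (simp add: circlepath_R_def)

lemma continuous_on_circlepath_R: "continuous_on S (circlepath_R R)"
  unfolding circlepath_R_def by (intro continuous_intros)

lemma circlepath_R_power:
  "circlepath_R R t ^ p = of_real (R ^ p) * exp (2 * of_real pi * \<i> * of_int (int p) * of_real t)"
  by (simp add: circlepath_R_def power_mult_distrib exp_of_nat_mult[symmetric] mult_ac)

lemma circlepath_R_inverse_power:
  "R > 0 \<Longrightarrow> (1 / circlepath_R R t) ^ p
     = of_real ((1/R) ^ p) * exp (2 * of_real pi * \<i> * of_int (- int p) * of_real t)"
  by (simp add: circlepath_R_def power_mult_distrib exp_of_nat_mult[symmetric] mult_ac exp_minus
      power_divide divide_simps)

lemma vector_derivative_circlepath_R:
  assumes "t \<in> {0..1}"
  shows "vector_derivative (circlepath_R R) (at t within {0..1}) = 2 * of_real pi * \<i> * circlepath_R R t"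
proof -
  have "((\<lambda>w. of_real R * exp (2 * of_real pi * \<i> * w)) has_field_derivative
          of_real R * (exp (2 * of_real pi * \<i> * of_real t) * (2 * of_real pi * \<i>))) (at (of_real t))"
    by (auto intro!: derivative_eq_intros)
  then have "(circlepath_R R has_vector_derivative
          of_real R * (exp (2 * of_real pi * \<i> * of_real t) * (2 * of_real pi * \<i>))) (at t)"
    unfolding circlepath_R_def[abs_def] by (rule has_vector_derivative_real_field)
  then show ?thesis using assms
    by (subst vector_derivative_at_within_ivl) (auto simp: circlepath_R_def mult_ac)
qed

definition circle_denom :: "(nat \<Rightarrow> complex) \<Rightarrow> real \<Rightarrow> nat \<Rightarrow> real \<Rightarrow> complex" where
  "circle_denom c R m t = (\<Prod>j<m. circlepath_R R t - c j)"

lemma norm_circle_denom_ge_1: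
  assumes "\<forall>j<m. cmod (c j) + 1 \<le> R"
  shows "norm (circle_denom c R m t) \<ge> 1"
proof -
  have "1 \<le> norm (circlepath_R R t - c j)" if "j < m" for j
  proof -
    have "R \<ge> 0" using assms that by (smt (verit) norm_ge_zero)
    then have "norm (circlepath_R R t) = R" by (rule norm_circlepath_R)
    moreover have "norm (circlepath_R R t) - norm (c j) \<le> norm (circlepath_R R t - c j)"
      by (rule norm_triangle_ineq2)
    ultimately show ?thesis using assms that by auto
  qed
  then show ?thesis unfolding circle_denom_def prod_norm[symmetric] by (intro prod_ge_1) auto
qed

lemma circle_denom_nonzero: "\<forall>j<m. cmod (c j) + 1 \<le> R \<Longrightarrow> circle_denom c R m t \<noteq> 0"
  using norm_circle_denom_ge_1[of m c R t] by auto

lemma continuous_on_circle_denom: "continuous_on S (circle_denom c R m)"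
  unfolding circle_denom_def by (intro continuous_intros continuous_on_circlepath_R)

section \<open>Moments of the reciprocal denominator\<close>

lemma circle_denom_geometric_expansion:
  assumes R1: "R \<ge> 1" and cR: "\<forall>j<Suc m. cmod (c j) + 1 \<le> R"
  shows "(\<lambda>i. c m ^ i * ((1 / circlepath_R R t) ^ (q + i + 1) / circle_denom c R m t))
           sums ((1 / circlepath_R R t) ^ q / circle_denom c R (Suc m) t)"
proof -
  define g where "g = circlepath_R R t"
  define a where "a = c m"
  have aR: "cmod a + 1 \<le> R" using cR by (auto simp: a_def)
  have g_norm: "norm g = R" using R1 by (simp add: g_def norm_circlepath_R)
  have g_nz: "g \<noteq> 0" using g_norm R1 by auto
  have ga_nz: "g - a \<noteq> 0"
  proof
    assume "g - a = 0"
    then have "norm g = norm a" by simp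
    then show False using g_norm aR by simp
  qed
  have denom_nz: "circle_denom c R m t \<noteq> 0" using cR by (intro circle_denom_nonzero) auto
  have "norm (a / g) < 1" using aR R1 by (simp add: norm_divide g_norm)
  then have geom: "(\<lambda>i. (a / g)^i * ((1/g)^(q+1) / circle_denom c R m t))
               sums (1 / (1 - a / g) * ((1/g)^(q+1) / circle_denom c R m t))"
    by (intro sums_mult2 geometric_sums)
  have terms: "(\<lambda>i. (a / g)^i * ((1/g)^(q+1) / circle_denom c R m t))
               = (\<lambda>i. a ^ i * ((1 / g) ^ (q + i + 1) / circle_denom c R m t))"
    by (auto simp: power_divide power_add field_simps)
  have limit: "1 / (1 - a / g) * ((1/g)^(q+1) / circle_denom c R m t)
               = (1 / g)^q / circle_denom c R (Suc m) t"
    using g_nz ga_nz denom_nz by (simp add: circle_denom_def a_def g_def field_simps power_add)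
  from geom[unfolded terms limit] show ?thesis by (simp only: a_def g_def)
qed

text \<open>Negative moments: the integral of g^{-q} / P_m is [q = 0 and m = 0].  For m > 0
  this is the vanishing of the contour integral of w^{-q-1}/P_m(w) around all poles.\<close>

lemma integral_inverse_power_over_denom:
  assumes R1: "R \<ge> 1" and cR: "\<forall>j<m. cmod (c j) + 1 \<le> R"
  shows "integral {0..1} (\<lambda>t. (1 / circlepath_R R t)^q / circle_denom c R m t)
       = (if q = 0 \<and> m = 0 then 1 else 0)"
  using cR
proof (induction m arbitrary: q)
  case 0
  have "integral {0..1} (\<lambda>t. (1 / circlepath_R R t)^q / circle_denom c R 0 t)
     = of_real ((1/R) ^ q) * integral {0..1} (\<lambda>t. exp (2 * of_real pi * \<i> * of_int (- int q) * of_real t))"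
    using R1 by (simp add: circle_denom_def circlepath_R_inverse_power)
  also have "\<dots> = (if q = 0 \<and> 0 = (0::nat) then 1 else 0)"
    by (simp only: integral_exp_2pi_int) simp
  finally show ?case .
next
  case (Suc m)
  have cR: "\<forall>j<m. cmod (c j) + 1 \<le> R" using Suc.prems by auto
  have aR: "cmod (c m) + 1 \<le> R" using Suc.prems by auto
  define f where "f i t = c m ^ i * ((1 / circlepath_R R t)^(q+i+1) / circle_denom c R m t)" for i t
  have cont: "continuous_on {0..1} (f i)" for i
    unfolding f_def using circle_denom_nonzero[OF cR] circlepath_R_nonzero[of R] R1
    by (intro continuous_intros continuous_on_circle_denom continuous_on_circlepath_R) auto
  have bound: "norm (f i t) \<le> (cmod (c m) / R)^i" for i t
  proof -
    have "norm (f i t) = cmod (c m) ^ i * ((1/R)^(q+i+1) / norm (circle_denom c R m t))"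
      using R1 by (simp add: f_def norm_mult norm_divide norm_power norm_circlepath_R)
    also have "\<dots> \<le> cmod (c m) ^ i * (1/R)^(q+i+1)"
      using norm_circle_denom_ge_1[OF cR, of t] R1
      by (intro mult_left_mono divide_by_ge_one_le) auto
    also have "\<dots> = (cmod (c m) / R)^i * (1/R)^(q+1)" by (simp add: power_add power_divide)
    also have "\<dots> \<le> (cmod (c m) / R)^i"
      using R1 by (intro mult_left_le power_le_one) auto
    finally show ?thesis .
  qed
  have "summable (\<lambda>i. (cmod (c m) / R)^i)"
    using aR R1 by (intro summable_geometric) simp
  then have "(\<lambda>i. integral {0..1} (f i)) sums integral {0..1} (\<lambda>t. \<Sum>i. f i t)"
    using cont bound by (intro integral_suminf_dominated)
  moreover have "(\<lambda>t. \<Sum>i. f i t) = (\<lambda>t. (1 / circlepath_R R t)^q / circle_denom c R (Suc m) t)"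
    using circle_denom_geometric_expansion[OF R1 Suc.prems] by (auto simp: f_def sums_iff)
  moreover have "integral {0..1} (f i) = 0" for i
    unfolding f_def integral_mult_right Suc.IH[OF cR] by simp
  ultimately show ?case by (simp add: sums_iff)
qed

text \<open>hpoly c p m is the complete homogeneous symmetric polynomial h_{p-m}(c_0, ..., c_{m-1})
  for p \<ge> m and 0 for p < m, given by its Pascal-type recursion.\<close>

fun hpoly :: "(nat \<Rightarrow> 'a::comm_semiring_1) \<Rightarrow> nat \<Rightarrow> nat \<Rightarrow> 'a" where
  "hpoly c p 0 = (if p = 0 then 1 else 0)"
| "hpoly c 0 (Suc m) = 0"
| "hpoly c (Suc p) (Suc m) = hpoly c p m + c m * hpoly c p (Suc m)"

text \<open>Positive moments: the integral of g^p / P_m equals hpoly c p m.  The induction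
  step uses the partial fraction identity g/(g - c_m) = 1 + c_m/(g - c_m).\<close>

lemma integral_power_over_denom:
  assumes R1: "R \<ge> 1"
  shows "\<forall>j<m. cmod (c j) + 1 \<le> R
         \<Longrightarrow> integral {0..1} (\<lambda>t. circlepath_R R t ^ p / circle_denom c R m t) = hpoly c p m"
proof (induction c p m rule: hpoly.induct)
  case (1 c p)
  have "integral {0..1} (\<lambda>t. circlepath_R R t ^ p / circle_denom c R 0 t)
     = of_real (R ^ p) * integral {0..1} (\<lambda>t. exp (2 * of_real pi * \<i> * of_int (int p) * of_real t))"
    by (simp add: circle_denom_def circlepath_R_power)
  also have "\<dots> = hpoly c p 0"
    by (simp only: integral_exp_2pi_int) simp
  finally show ?case .
next
  case (2 c m)
  then show ?case using integral_inverse_power_over_denom[OF R1 2, of 0] by simp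
next
  case (3 c p m)
  have cR: "\<forall>j<m. cmod (c j) + 1 \<le> R" using 3 by auto
  let ?g = "circlepath_R R"
  have nz: "?g t - c m \<noteq> 0" for t
  proof
    assume "?g t - c m = 0"
    then have "norm (?g t) = norm (c m)" by simp
    then show False using norm_circlepath_R[of R t] R1 3(3) by auto
  qed
  have partial_fraction: "?g t ^ Suc p / circle_denom c R (Suc m) t
      = ?g t ^ p / circle_denom c R m t + c m * (?g t ^ p / circle_denom c R (Suc m) t)" for t
    using circle_denom_nonzero[OF cR, of t] nz[of t] by (simp add: circle_denom_def field_simps)
  have int1: "(\<lambda>t. ?g t ^ p / circle_denom c R m t) integrable_on {0..1}"
    using circle_denom_nonzero[OF cR]
    by (intro integrable_continuous_real continuous_intros continuous_on_circle_denom
        continuous_on_circlepath_R) auto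
  have int2: "(\<lambda>t. c m * (?g t ^ p / circle_denom c R (Suc m) t)) integrable_on {0..1}"
    using circle_denom_nonzero[OF 3(3)]
    by (intro integrable_continuous_real continuous_intros continuous_on_circle_denom
        continuous_on_circlepath_R) auto
  have "integral {0..1} (\<lambda>t. ?g t ^ Suc p / circle_denom c R (Suc m) t)
     = integral {0..1} (\<lambda>t. ?g t ^ p / circle_denom c R m t)
       + integral {0..1} (\<lambda>t. c m * (?g t ^ p / circle_denom c R (Suc m) t))"
    unfolding partial_fraction by (rule integral_add[OF int1 int2])
  also have "\<dots> = hpoly c p m + c m * hpoly c p (Suc m)"
    using 3(1)[OF cR] 3(2)[OF 3(3)] unfolding integral_mult_right by (simp only:)
  finally show ?case by simp
qed

section \<open>Power series of the fundamental function\<close>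

text \<open>Using g' = 2 pi i g, the defining contour integral becomes a plain integral.\<close>

lemma fundamental_fun_eq_integral:
  assumes R: "R = Max ((\<lambda>j. cmod (c j)) ` {0..n}) + 1"
  shows "fundamental_fun n c z
       = integral {0..1} (\<lambda>t. exp (z * circlepath_R R t) * circlepath_R R t / circle_denom c R (Suc n) t)"
proof -
  let ?g = "circlepath_R R"
  have denom: "(\<Prod>j=0..n. ?g t - c j) = circle_denom c R (Suc n) t" for t
    by (simp add: circle_denom_def atLeast0AtMost lessThan_Suc_atMost)
  have "integral {0..1} (\<lambda>t. exp (z * ?g t) / circle_denom c R (Suc n) t
                 * vector_derivative ?g (at t within {0..1}))
      = integral {0..1} (\<lambda>t. (2 * complex_of_real pi * \<i>)
                 * (exp (z * ?g t) * ?g t / circle_denom c R (Suc n) t))"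
    by (rule integral_cong) (simp add: vector_derivative_circlepath_R)
  then show ?thesis
    unfolding fundamental_fun_def Let_def R[symmetric] denom integral_mult_right by simp
qed

lemma fundamental_fun_sums:
  fixes c :: "nat \<Rightarrow> complex"
  shows "(\<lambda>k. z^k / of_nat (fact k) * hpoly c (Suc k) (Suc n)) sums fundamental_fun n c z"
proof -
  define R where "R = Max ((\<lambda>j. cmod (c j)) ` {0..n}) + 1"
  have cR: "\<forall>j<Suc n. cmod (c j) + 1 \<le> R"
    unfolding R_def by (auto intro!: Max_ge)
  have R1: "R \<ge> 1" using cR[rule_format, of 0] by (smt (verit) norm_ge_zero zero_less_Suc)
  let ?g = "circlepath_R R" and ?P = "circle_denom c R (Suc n)"
  have g_norm: "norm (?g t) = R" for t using R1 by (simp add: norm_circlepath_R)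
  define f where "f k t = z^k / of_nat (fact k) * (?g t ^ Suc k / ?P t)" for k t
  have pointwise: "(\<lambda>k. f k t) sums (exp (z * ?g t) * ?g t / ?P t)" for t
  proof -
    have "(\<lambda>k. (z * ?g t)^k /\<^sub>R fact k * (?g t / ?P t)) sums (exp (z * ?g t) * (?g t / ?P t))"
      by (intro sums_mult2 exp_converges)
    moreover have "(\<lambda>k. (z * ?g t)^k /\<^sub>R fact k * (?g t / ?P t)) = (\<lambda>k. f k t)"
      by (auto simp: f_def scaleR_conv_of_real power_mult_distrib divide_inverse mult_ac)
    ultimately show ?thesis by simp
  qed
  have cont: "continuous_on {0..1} (f k)" for k
    unfolding f_def using circle_denom_nonzero[OF cR]
    by (intro continuous_intros continuous_on_circle_denom continuous_on_circlepath_R) auto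
  have bound: "norm (f k t) \<le> inverse (fact k) * (norm z * R)^k * R" for k t
  proof -
    have "norm (f k t) = norm z ^ k / fact k * (R ^ Suc k / norm (?P t))"
      by (simp add: f_def norm_mult norm_divide norm_power g_norm)
    also have "\<dots> \<le> norm z ^ k / fact k * R ^ Suc k"
      using norm_circle_denom_ge_1[OF cR, of t] R1
      by (intro mult_left_mono divide_by_ge_one_le) auto
    also have "\<dots> = inverse (fact k) * (norm z * R)^k * R"
      by (simp add: power_mult_distrib divide_inverse mult_ac)
    finally show ?thesis .
  qed
  have "summable (\<lambda>k. inverse (fact k) * (norm z * R)^k * R)"
    by (intro summable_mult2 summable_exp)
  then have "(\<lambda>k. integral {0..1} (f k)) sums integral {0..1} (\<lambda>t. \<Sum>k. f k t)"
    using cont bound by (intro integral_suminf_dominated)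
  moreover have "(\<lambda>t. \<Sum>k. f k t) = (\<lambda>t. exp (z * ?g t) * ?g t / ?P t)"
    using pointwise by (auto simp: sums_iff)
  moreover have "integral {0..1} (f k) = z^k / of_nat (fact k) * hpoly c (Suc k) (Suc n)" for k
    unfolding f_def integral_mult_right integral_power_over_denom[OF R1 cR] ..
  ultimately show ?thesis using fundamental_fun_eq_integral[OF R_def] by simp
qed

section \<open>Positivity and monotonicity of the coefficients\<close>

lemma hpoly_of_real: "hpoly (\<lambda>j. complex_of_real (c j)) p m = of_real (hpoly c p m)"
  by (induction c p m rule: hpoly.induct) auto

lemma hpoly_nonneg: "\<forall>j<m. 0 \<le> c j \<Longrightarrow> 0 \<le> hpoly c p m" for c :: "nat \<Rightarrow> real"
  by (induction c p m rule: hpoly.induct) auto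

lemma hpoly_mono:
  fixes c d :: "nat \<Rightarrow> real"
  shows "\<forall>j<m. 0 \<le> c j \<and> c j \<le> d j \<Longrightarrow> hpoly c p m \<le> hpoly d p m"
proof (induction c p m rule: hpoly.induct)
  case (3 c p m)
  have "c m * hpoly c p (Suc m) \<le> d m * hpoly d p (Suc m)"
    using 3 hpoly_nonneg[of "Suc m" c p] by (intro mult_mono) auto
  then show ?case using 3 by simp
qed auto

lemma hpoly_diag: "\<forall>j<m. 0 \<le> c j \<Longrightarrow> 1 \<le> hpoly c m m" for c :: "nat \<Rightarrow> real"
proof (induction m)
  case (Suc m)
  have "0 \<le> c m * hpoly c m (Suc m)" using Suc.prems hpoly_nonneg[of "Suc m" c m] by simp
  then show ?case using Suc by simp
qed simp

lemma fundamental_fun_of_real: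
  fixes c :: "nat \<Rightarrow> real" and x :: real and n :: nat
  defines "a \<equiv> \<lambda>k. x^k / fact k * hpoly c (Suc k) (Suc n)"
  shows "a sums Re (fundamental_fun n (\<lambda>j. of_real (c j)) (of_real x))"
    and "fundamental_fun n (\<lambda>j. of_real (c j)) (of_real x) \<in> \<real>"
proof -
  have "(\<lambda>k. complex_of_real (a k)) sums fundamental_fun n (\<lambda>j. of_real (c j)) (of_real x)"
    using fundamental_fun_sums[of "of_real x" "\<lambda>j. of_real (c j)" n]
    by (simp add: a_def hpoly_of_real)
  from sums_Re[OF this] sums_Im[OF this]
  show "a sums Re (fundamental_fun n (\<lambda>j. of_real (c j)) (of_real x))"
    and "fundamental_fun n (\<lambda>j. of_real (c j)) (of_real x) \<in> \<real>"
    by (auto simp: complex_is_Real_iff sums_iff)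
qed

lemma fundamental_fun_pos:
  fixes c :: "nat \<Rightarrow> real"
  assumes c: "\<forall>j\<le>n. 0 \<le> c j" and x: "x > 0"
  shows "Re (fundamental_fun n (\<lambda>j. of_real (c j)) (of_real x)) > 0"
proof -
  have c': "\<forall>j<Suc n. 0 \<le> c j" using c by auto
  let ?a = "\<lambda>k. x^k / fact k * hpoly c (Suc k) (Suc n)"
  have "0 < suminf ?a"
  proof (rule suminf_pos2)
    show "summable ?a" using fundamental_fun_of_real(1) by (auto simp: sums_iff)
    show "0 \<le> ?a k" for k using hpoly_nonneg[OF c', of "Suc k"] x by (simp del: hpoly.simps)
    show "0 < ?a n" using hpoly_diag[OF c'] x by (simp add: less_le_trans[OF zero_less_one])
  qed
  then show ?thesis using fundamental_fun_of_real(1)[of x c n] by (simp add: sums_iff)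
qed

text \<open>Triangle inequality on the Taylor series plus monotonicity of the coefficients.\<close>

lemma norm_fundamental_fun_le:
  fixes c d :: "nat \<Rightarrow> real"
  assumes cd: "\<forall>j\<le>n. 0 \<le> c j \<and> c j \<le> d j"
  shows "cmod (fundamental_fun n (\<lambda>j. of_real (c j)) z)
       \<le> Re (fundamental_fun n (\<lambda>j. of_real (d j)) (of_real (cmod z)))"
proof -
  have cd': "\<forall>j<Suc n. 0 \<le> c j \<and> c j \<le> d j" using cd by auto
  then have c': "\<forall>j<Suc n. 0 \<le> c j" by auto
  define t where "t k = z^k / of_nat (fact k) * hpoly (\<lambda>j. of_real (c j)) (Suc k) (Suc n)" for k
  define a where "a e k = cmod z ^ k / fact k * hpoly e (Suc k) (Suc n)" for e k
  have series: "a e sums Re (fundamental_fun n (\<lambda>j. of_real (e j)) (of_real (cmod z)))" for e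
    unfolding a_def by (rule fundamental_fun_of_real(1))
  have norm_t: "norm (t k) = a c k" for k
    using hpoly_nonneg[OF c', of "Suc k"]
    by (simp add: t_def a_def hpoly_of_real norm_mult norm_divide norm_power del: hpoly.simps)
  have summable_t: "summable (\<lambda>k. norm (t k))" unfolding norm_t using series by (auto simp: sums_iff)
  have "t sums fundamental_fun n (\<lambda>j. of_real (c j)) z"
    unfolding t_def by (rule fundamental_fun_sums)
  then have "cmod (fundamental_fun n (\<lambda>j. of_real (c j)) z) = norm (suminf t)"
    by (simp add: sums_iff)
  also have "\<dots> \<le> (\<Sum>k. norm (t k))" by (rule summable_norm[OF summable_t])
  also have "\<dots> \<le> suminf (a d)"
    using summable_t series[of d] hpoly_mono[OF cd'] unfolding norm_t a_def
    by (intro suminf_le mult_left_mono) (auto simp: sums_iff simp del: hpoly.simps)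
  also have "\<dots> = Re (fundamental_fun n (\<lambda>j. of_real (d j)) (of_real (cmod z)))"
    using series by (simp add: sums_iff)
  finally show ?thesis .
qed

theorem mainTheorem5:
  fixes n :: nat and lam mu :: "nat \<Rightarrow> real"
  assumes "\<forall>j\<le>n. 0 \<le> lam j \<and> lam j \<le> mu j"
  shows "(\<forall>x::real. fundamental_fun n (\<lambda>j. complex_of_real (lam j)) (complex_of_real x) \<in> \<real>)
       \<and> (\<forall>x::real. x > 0 \<longrightarrow> Re (fundamental_fun n (\<lambda>j. complex_of_real (lam j)) (complex_of_real x)) > 0)
       \<and> (\<forall>z::complex. cmod (fundamental_fun n (\<lambda>j. complex_of_real (lam j)) z)
              \<le> Re (fundamental_fun n (\<lambda>j. complex_of_real (mu j)) (complex_of_real (cmod z))))"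
  using fundamental_fun_of_real(2) fundamental_fun_pos norm_fundamental_fun_le[OF assms] assms
  by auto

end
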